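(* Let $(Y,d)$ be a metric space and let $(K_r)_{r\in R}$ be a collection of non-empty compact subsets of $Y$ indexed by a non-empty metric space $(R,\gamma)$ such that $\mathcal{H}(K_r,K_s)\le\gamma(r,s)$ for every $r,s\in R$, where $\mathcal H$ is the Hausdorff distance. Assume $O$ is a $G_\delta$ subset of $Y$ that contains a $\gamma$-dense subset of the family $(K_r)_{r\in R}$ (i.e. there is a $\gamma$-dense $R'\subseteq R$ with $K_r\subseteq O$ for all $r\in R'$), and let $r_0\in R$ be such that $K_{r_0}\subseteq O$. Assume further that there exist $\rho>0$ and $\varepsilon_0>0$ such that for every $\varepsilon\in(0,\varepsilon_0)$ we can find a set of indices $R(\varepsilon)\subseteq R$ such that: - for every $s\in R$ there exists $t\in R(\varepsilon)$ with $\gamma(t,s)<\varepsilon$; - for every subset $S$ of $Y$ of diameter at most $\rho\varepsilon$ the set $\{r\in R(\varepsilon): S\cap K_r\neq\emptyset\}$ is finite. Then there exists a nested collection of non-empty closed subsets $(T_\lambda)_{0\le\lambda\le1}$ of $Y$, each contained in $O$, with $T_{\lambda'}\subseteq T_\lambda$ whenever $0\le\lambda'\le\lambda\le1$, each containing $K_{r_0}$, that satisfies the following. For each $\eta>0$, $\lambda\in(0,1]$ and $y\in\bigcup_{0\le\lambda'<\lambda}T_{\lambda'}$ there exists $\delta_1=\delta_1(\eta,\lambda,y)>0$ such that if $\delta\in(0,\delta_1)$ and $s\in R$ with $K_s\subseteq\overline{B}_\delta(y)$, then there exists $t\in R$ such that $K_t\subseteq T_\lambda$ and $\gamma(t,s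)<\eta\delta$.
   Context: $\overline{B}_r(A)$ denotes the closed $r$-neighbourhood of a set $A$ (or of a point), and $\mathcal{H}(K_1,K_2)=\inf\{r>0: K_1\subseteq\overline{B}_r(K_2)\text{ and }K_2\subseteq\overline{B}_r(K_1)\}$. *)

theory Defs
  imports "HOL-Analysis.Analysis"
begin

text \<open>
  The guard \<open>A \<noteq> {}\<close> is needed because \<^const>\<open>infdist\<close> to the empty set is \<open>0\<close> by convention.
\<close>
definition closed_nbhd :: "real \<Rightarrow> 'a::metric_space set \<Rightarrow> 'a set" where
  "closed_nbhd r A = {x. A \<noteq> {} \<and> infdist x A \<le> r}"

text \<open>
  The infimum is taken in the reals, so the value is meaningful only if the set of admissible
  radii is non-empty, for instance if both sets are bounded and non-empty.
\<close>
definition hausdorff_dist :: "'a::metric_space set \<Rightarrow> 'a set \<Rightarrow> real" where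
  "hausdorff_dist K L = Inf {r. r > 0 \<and> K \<subseteq> closed_nbhd r L \<and> L \<subseteq> closed_nbhd r K}"

lemma closed_nbhd_singleton: "closed_nbhd r {y} = cball y r"
  by (auto simp: closed_nbhd_def dist_commute)

lemma closed_nbhd_compact:
  assumes "compact A"
  shows "closed_nbhd r A = (\<Union>a\<in>A. cball a r)"
proof (cases "A = {}")
  case False
  show ?thesis
  proof (intro equalityI subsetI)
    fix x assume x: "x \<in> closed_nbhd r A"
    have "continuous_on A (dist x)" by (intro continuous_intros)
    then obtain a where "a \<in> A" "\<forall>b\<in>A. dist x a \<le> dist x b"
      using continuous_attains_inf[OF assms False] by blast
    moreover from this have "dist x a \<le> infdist x A"
      using False by (auto simp: infdist_notempty intro: cINF_greatest)
    ultimately show "x \<in> (\<Union>a\<in>A. cball a r)"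
      using x by (force simp: closed_nbhd_def dist_commute)
  next
    fix x assume "x \<in> (\<Union>a\<in>A. cball a r)"
    then obtain a where "a \<in> A" "dist x a \<le> r" by (auto simp: dist_commute)
    then show "x \<in> closed_nbhd r A"
      using infdist_le[of a A x] by (auto simp: closed_nbhd_def)
  qed
qed (simp add: closed_nbhd_def)

end

theory Submission
  imports Defs
begin

text \<open>
  Write \<open>G\<close> as the intersection of decreasing open sets \<open>U k\<close>. The sets \<open>T l\<close> are built from an
  increasing sequence of closed sets \<open>F k \<subseteq> G\<close>, each a union of members of the family, and from
  positive functions \<open>w k\<close> on \<open>Y\<close> that prescribe how far \<open>F k\<close> may be thickened near a point
  without leaving \<open>U k\<close>. With \<open>tube F w l = {x. infdist x F \<le> l * w x}\<close>, a point belongs to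
  \<open>T l\<close> if for every \<open>n\<close> it belongs to \<open>tube (F k) (w k) l\<close> for some \<open>k\<close> in the window \<open>n \<le> k \<le> (1+l)n\<close>.
  Levels \<open>k \<ge> n\<close> give \<open>tube (F k) (w k) l \<subseteq> U n\<close>, so \<open>T l \<subseteq> G\<close>; the windows are finite, so \<open>T l\<close>
  is closed; and \<open>K r0 \<subseteq> F 0 \<subseteq> F n\<close> for all \<open>n\<close>, so \<open>K r0 \<subseteq> T 0\<close>.

  A single sequence of tubes would not do. The set \<open>F k\<close> in general approximates the family only up
  to an error far larger than \<open>w k\<close>, because \<open>w k\<close> is chosen after \<open>F k\<close>; so at scales \<open>\<delta>\<close>
  a little above \<open>w k y\<close> one may fail to find a good \<open>K t\<close> inside the \<open>k\<close>th tube. The windows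
  \<open>n \<le> k \<le> (1+l)n\<close> cure this. Let \<open>y \<in> T l'\<close> with \<open>l' < l\<close>, and let \<open>m\<close> be the first level at
  which \<open>w m y\<close> is not large compared with \<open>\<delta>\<close>. A level before \<open>m\<close> whose \<open>l'\<close>-tube contains
  \<open>y\<close> has an \<open>l\<close>-tube that contains the whole \<open>2\<delta>\<close>-ball about \<open>y\<close> (lemma \<open>cball_subset_tube\<close>).
  For the windows that reach \<open>m\<close> we use instead that the next set \<open>F (m+1)\<close> approximates the
  family up to an error that is a small multiple of \<open>w m\<close>, hence of \<open>\<delta>\<close>; increasing the parameter
  from \<open>l'\<close> to \<open>l\<close> lengthens these windows enough to include \<open>m+1\<close>, once \<open>m\<close> is large. This is
  lemma \<open>approximation_in_nested_tubes\<close>.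

  What remains is to find, for a given function \<open>w\<close>, a closed union of members of the
  family inside \<open>G\<close> that approximates every \<open>K s\<close> up to the error \<open>w\<close>. The function \<open>w\<close> is not
  bounded away from \<open>0\<close>, so no single \<open>R(\<epsilon>)\<close> is fine enough. In lemma \<open>variable_scale_net\<close> the sets
  \<open>R(\<epsilon>)\<close>, moved slightly so as to lie in \<open>G\<close>, are used for all \<open>\<epsilon>\<close> of the form \<open>2^-j \<epsilon>0\<close> together, but
  from \<open>R(\<epsilon>)\<close> only those indices \<open>r\<close> are kept for which \<open>w \<le> 6\<epsilon>\<close> throughout \<open>K r\<close>. Near a point
  \<open>y\<close> this leaves only \<open>\<epsilon>\<close> comparable with or larger than \<open>w y\<close>, which are finitely many,
  and so the union is locally finite.
\<close>

section \<open>Consequences of the Hausdorff estimate\<close>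

text \<open>
  The infimum defining the Hausdorff distance runs over a non-empty set of radii since both sets are
  bounded, and the nearest point is attained by compactness; so no \<open>\<epsilon>\<close> is lost.
\<close>
lemma hausdorff_dist_le_imp_close_point:
  fixes A B :: "'a::metric_space set"
  assumes "compact A" "compact B" "A \<noteq> {}" "B \<noteq> {}"
    and le: "hausdorff_dist A B \<le> d" and x: "x \<in> A"
  shows "\<exists>y\<in>B. dist x y \<le> d"
proof -
  let ?S = "{r. r > 0 \<and> A \<subseteq> closed_nbhd r B \<and> B \<subseteq> closed_nbhd r A}"
  have ne: "?S \<noteq> {}"
  proof -
    obtain a b where a: "a \<in> A" and b: "b \<in> B" using assms by blast
    have "bounded (A \<union> B)" using assms(1,2) by (simp add: compact_imp_bounded)
    then obtain e where e: "\<And>u v. u \<in> A \<union> B \<Longrightarrow> v \<in> A \<union> B \<Longrightarrow> dist u v \<le> e"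
      by (metis bounded_two_points)
    have "A \<subseteq> closed_nbhd (max e 1) B"
      using b e by (force simp: closed_nbhd_def intro!: infdist_le2[of b])
    moreover have "B \<subseteq> closed_nbhd (max e 1) A"
      using a e by (force simp: closed_nbhd_def intro!: infdist_le2[of a])
    ultimately have "max e 1 \<in> ?S" by simp
    then show ?thesis by blast
  qed
  have "infdist x B \<le> d"
  proof (rule field_le_epsilon)
    fix e :: real assume "e > 0"
    then have "Inf ?S < d + e" using le by (simp add: hausdorff_dist_def)
    then obtain r where "r \<in> ?S" "r < d + e" using ne by (meson cInf_lessD)
    then show "infdist x B \<le> d + e" using x by (auto simp: closed_nbhd_def)
  qed
  then have "x \<in> closed_nbhd d B" using assms by (simp add: closed_nbhd_def)
  then show ?thesis by (auto simp: closed_nbhd_compact[OF assms(2)] dist_commute)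
qed

lemma lipschitz_one_le:
  fixes w :: "'a::metric_space \<Rightarrow> real"
  assumes "1-lipschitz_on UNIV w"
  shows "w x \<le> w y + dist x y"
  using lipschitz_onD[OF assms, of x y] by (simp add: dist_real_def)

section \<open>Nets of variable fineness with closed union\<close>

lemma closed_Union_locally_finite_family:
  fixes K :: "'r \<Rightarrow> 'y::metric_space set"
  assumes "\<And>r. closed (K r)"
    and fin: "\<And>y. \<exists>\<theta>>0. finite {r\<in>N. cball y \<theta> \<inter> K r \<noteq> {}}"
  shows "closed (\<Union>r\<in>N. K r)"
proof -
  have "closedin euclidean (\<Union>(K ` N))"
  proof (rule closedin_locally_finite_Union)
    show "locally_finite_in euclidean (K ` N)"
      unfolding locally_finite_in_def
    proof safe
      fix y :: 'y
      obtain \<theta> where \<theta>: "\<theta> > 0" "finite {r\<in>N. cball y \<theta> \<inter> K r \<noteq> {}}" using fin by blast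
      have "{U \<in> K ` N. U \<inter> ball y \<theta> \<noteq> {}} \<subseteq> K ` {r\<in>N. cball y \<theta> \<inter> K r \<noteq> {}}"
        using ball_subset_cball[of y \<theta>] by blast
      then have "finite {U \<in> K ` N. U \<inter> ball y \<theta> \<noteq> {}}"
        using \<theta>(2) finite_surj by blast
      then show "\<exists>V. openin euclidean V \<and> y \<in> V \<and> finite {U \<in> K ` N. U \<inter> V \<noteq> {}}"
        using \<theta>(1) by (intro exI[of _ "ball y \<theta>"]) auto
    qed auto
  qed (use assms(1) in auto)
  then show ?thesis by simp
qed

text \<open>
  Moving each index of a net by less than \<open>\<epsilon>\<close> costs a factor \<open>2\<close> in fineness; moving it by
  less than \<open>\<rho>\<epsilon>/4\<close> ensures that a moved member meeting a ball of radius \<open>\<rho>\<epsilon>/4\<close> comes from a member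
  meeting the ball of radius \<open>\<rho>\<epsilon>/2\<close>, whose diameter is at most \<open>\<rho>\<epsilon>\<close>.
\<close>
lemma net_in_dense_subset:
  fixes K :: "'r::metric_space \<Rightarrow> 'y::metric_space set"
  assumes close: "\<forall>r s. \<forall>x\<in>K r. \<exists>x'\<in>K s. dist x x' \<le> dist r s"
    and dense: "closure D = UNIV"
    and "\<rho> > 0" "\<epsilon> > 0"
    and net: "\<And>s. \<exists>t\<in>R. dist t s < \<epsilon>"
    and fin: "\<And>S. bounded S \<Longrightarrow> diameter S \<le> \<rho> * \<epsilon> \<Longrightarrow> finite {r\<in>R. S \<inter> K r \<noteq> {}}"
  shows "\<exists>P\<subseteq>D. (\<forall>s. \<exists>t\<in>P. dist t s < 2 * \<epsilon>) \<and>
               (\<forall>y. finite {t\<in>P. cball y (\<rho> * \<epsilon> / 4) \<inter> K t \<noteq> {}})"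
proof -
  define e where "e = min \<epsilon> (\<rho> * \<epsilon> / 4)"
  have "e > 0" using assms by (simp add: e_def)
  then have "\<forall>r. \<exists>d\<in>D. dist d r < e"
    using dense by (metis UNIV_I closure_approachable)
  then obtain p where p: "\<And>r. p r \<in> D" "\<And>r. dist (p r) r < e" by metis
  show ?thesis
  proof (intro exI[of _ "p ` R"] conjI allI)
    show "p ` R \<subseteq> D" using p by blast
    fix s
    obtain t where t: "t \<in> R" "dist t s < \<epsilon>" using net by blast
    then have "dist (p t) s < 2 * \<epsilon>"
      using p(2)[of t] dist_triangle[of "p t" s t] by (simp add: e_def)
    then show "\<exists>t\<in>p ` R. dist t s < 2 * \<epsilon>" using t by blast
  next
    fix y :: 'y
    let ?B = "cball y (\<rho> * \<epsilon> / 2)"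
    have "diameter ?B \<le> \<rho> * \<epsilon>"
    proof -
      have "dist a b \<le> \<rho> * \<epsilon>" if "a \<in> ?B" "b \<in> ?B" for a b
        using dist_triangle3[of a b y] that by simp
      moreover have "y \<in> ?B" using assms by simp
      ultimately show ?thesis
        unfolding diameter_def by (auto simp del: mem_cball intro!: cSUP_least)
    qed
    then have "finite {r\<in>R. ?B \<inter> K r \<noteq> {}}" by (intro fin) auto
    moreover have "{t \<in> p ` R. cball y (\<rho> * \<epsilon> / 4) \<inter> K t \<noteq> {}} \<subseteq> p ` {r\<in>R. ?B \<inter> K r \<noteq> {}}"
    proof
      fix t assume "t \<in> {t \<in> p ` R. cball y (\<rho> * \<epsilon> / 4) \<inter> K t \<noteq> {}}"
      then obtain r x where r: "r \<in> R" and t: "t = p r"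
        and x: "x \<in> cball y (\<rho> * \<epsilon> / 4)" "x \<in> K (p r)" by blast
      obtain x' where "x' \<in> K r" "dist x x' \<le> dist (p r) r" using close x by blast
      moreover have "dist (p r) r < \<rho> * \<epsilon> / 4" using p(2)[of r] by (simp add: e_def)
      ultimately have "x' \<in> ?B \<inter> K r"
        using x dist_triangle[of y x' x] by simp
      then show "t \<in> p ` {r\<in>R. ?B \<inter> K r \<noteq> {}}" using r t by blast
    qed
    ultimately show "finite {t \<in> p ` R. cball y (\<rho> * \<epsilon> / 4) \<inter> K t \<noteq> {}}"
      using finite_surj by blast
  qed
qed

text \<open>
  The error allowed at \<open>s\<close> is the largest value of \<open>w\<close> on \<open>K s\<close>, not the smallest. Asking for the
  smallest would break local finiteness: near a point where \<open>w\<close> is large there may be infinitely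
  many members that elsewhere run into regions where \<open>w\<close> is tiny.
\<close>
lemma variable_scale_net:
  fixes K :: "'r::metric_space \<Rightarrow> 'y::metric_space set"
  assumes K_ne: "\<And>r. K r \<noteq> {}" and K_compact: "\<And>r. compact (K r)"
    and close: "\<forall>r s. \<forall>x\<in>K r. \<exists>x'\<in>K s. dist x x' \<le> dist r s"
    and "\<rho> > 0" "\<epsilon>0 > 0"
    and nets: "\<And>\<epsilon>. 0 < \<epsilon> \<Longrightarrow> \<epsilon> < \<epsilon>0 \<Longrightarrow>
      \<exists>P\<subseteq>D. (\<forall>s. \<exists>t\<in>P. dist t s < 2 * \<epsilon>) \<and>
            (\<forall>y. finite {t\<in>P. cball y (\<rho> * \<epsilon> / 4) \<inter> K t \<noteq> {}})"
    and w_pos: "\<And>x. 0 < w x" and w_le: "\<And>x. w x \<le> \<epsilon>0" and w_lip: "1-lipschitz_on UNIV w"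
  shows "\<exists>N\<subseteq>D. closed (\<Union>r\<in>N. K r) \<and> (\<forall>s. \<exists>t\<in>N. \<exists>x\<in>K s. dist t s < w x)"
proof -
  define \<epsilon> where "\<epsilon> j = \<epsilon>0 * (1/2::real) ^ j" for j
  have \<epsilon>_pos: "\<epsilon> j > 0" for j using \<open>\<epsilon>0 > 0\<close> by (simp add: \<epsilon>_def)
  have \<epsilon>_small: "\<exists>n. \<epsilon> n < e" if "e > 0" for e
    using real_arch_pow_inv[of "e / \<epsilon>0" "1/2"] that \<open>\<epsilon>0 > 0\<close> by (auto simp: \<epsilon>_def field_simps)
  have "\<exists>P. \<forall>j. \<epsilon> j < \<epsilon>0 \<longrightarrow> P j \<subseteq> D \<and> (\<forall>s. \<exists>t\<in>P j. dist t s < 2 * \<epsilon> j) \<and>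
            (\<forall>y. finite {t\<in>P j. cball y (\<rho> * \<epsilon> j / 4) \<inter> K t \<noteq> {}})"
    by (rule choice, rule allI) (use nets[OF \<epsilon>_pos] in blast)
  then obtain P where P_sub: "\<And>j. \<epsilon> j < \<epsilon>0 \<Longrightarrow> P j \<subseteq> D"
    and P_net: "\<And>j s. \<epsilon> j < \<epsilon>0 \<Longrightarrow> \<exists>t\<in>P j. dist t s < 2 * \<epsilon> j"
    and P_fin: "\<And>j y. \<epsilon> j < \<epsilon>0 \<Longrightarrow> finite {t\<in>P j. cball y (\<rho> * \<epsilon> j / 4) \<inter> K t \<noteq> {}}"
    by blast
  define Q where "Q j = {t \<in> P j. \<epsilon> j < \<epsilon>0 \<and> (\<forall>x\<in>K t. w x \<le> 6 * \<epsilon> j)}" for j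
  define N where "N = (\<Union>j. Q j)"
  have "N \<subseteq> D" using P_sub by (auto simp: N_def Q_def)
  moreover have "closed (\<Union>r\<in>N. K r)"
  proof (rule closed_Union_locally_finite_family)
    show "closed (K r)" for r using K_compact compact_imp_closed by blast
    fix y
    \<comment> \<open>If \<open>K t\<close> with \<open>t \<in> Q j\<close> meets the ball of radius \<open>\<theta>\<close>, then \<open>w y \<le> 6 \<epsilon> j + \<theta>\<close>, so the first
        bound on \<open>\<theta>\<close> gives \<open>w y \<le> 12 \<epsilon> j\<close>; then the second gives \<open>\<theta> \<le> \<rho> * \<epsilon> j / 4\<close>.\<close>
    define \<theta> where "\<theta> = min (w y / 2) (\<rho> * w y / 48)"
    have \<theta>: "\<theta> > 0" using w_pos assms by (simp add: \<theta>_def)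
    define J where "J = {j. w y \<le> 12 * \<epsilon> j \<and> \<epsilon> j < \<epsilon>0}"
    have "finite J"
    proof -
      obtain n where n: "\<epsilon> n < w y / 12"
        using \<epsilon>_small[of "w y / 12"] w_pos[of y] by auto
      have "j < n" if "j \<in> J" for j
      proof (rule ccontr)
        assume "\<not> j < n"
        then have "\<epsilon> j \<le> \<epsilon> n" using \<open>\<epsilon>0 > 0\<close> by (simp add: \<epsilon>_def power_decreasing)
        then show False using n that by (simp add: J_def)
      qed
      then show ?thesis by (meson finite_nat_set_iff_bounded)
    qed
    moreover have "{r\<in>N. cball y \<theta> \<inter> K r \<noteq> {}} \<subseteq>
        (\<Union>j\<in>J. {t\<in>P j. cball y (\<rho> * \<epsilon> j / 4) \<inter> K t \<noteq> {}})"
    proof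
      fix t assume "t \<in> {r\<in>N. cball y \<theta> \<inter> K r \<noteq> {}}"
      then obtain x where "t \<in> N" and x: "x \<in> cball y \<theta>" "x \<in> K t" by blast
      then obtain j where j: "t \<in> P j" "\<epsilon> j < \<epsilon>0" "w x \<le> 6 * \<epsilon> j"
        by (auto simp: N_def Q_def)
      have "w y \<le> w x + \<theta>" using lipschitz_one_le[OF w_lip, of y x] x(1) by simp
      then have wy: "w y \<le> 12 * \<epsilon> j" using j(3) by (simp add: \<theta>_def)
      then have "\<rho> * w y \<le> \<rho> * (12 * \<epsilon> j)" using \<open>\<rho> > 0\<close> by (intro mult_left_mono) auto
      then have "\<theta> \<le> \<rho> * \<epsilon> j / 4" by (simp add: \<theta>_def)
      then have "x \<in> cball y (\<rho> * \<epsilon> j / 4)" using x(1) by simp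
      then have "cball y (\<rho> * \<epsilon> j / 4) \<inter> K t \<noteq> {}" using x(2) by blast
      then show "t \<in> (\<Union>j\<in>J. {t\<in>P j. cball y (\<rho> * \<epsilon> j / 4) \<inter> K t \<noteq> {}})"
        using j wy unfolding J_def by blast
    qed
    moreover have "finite {t\<in>P j. cball y (\<rho> * \<epsilon> j / 4) \<inter> K t \<noteq> {}}" if "j \<in> J" for j
      using P_fin that by (simp add: J_def)
    ultimately have "finite {r\<in>N. cball y \<theta> \<inter> K r \<noteq> {}}"
      by (metis (no_types, lifting) finite_UN_I finite_subset)
    then show "\<exists>\<theta>>0. finite {r\<in>N. cball y \<theta> \<inter> K r \<noteq> {}}" using \<theta> by blast
  qed
  moreover have "\<exists>t\<in>N. \<exists>x\<in>K s. dist t s < w x" for s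
  proof -
    have "continuous_on (K s) w"
      using w_lip lipschitz_on_continuous_on lipschitz_on_subset by blast
    then obtain x where x: "x \<in> K s" and max: "\<And>z. z \<in> K s \<Longrightarrow> w z \<le> w x"
      using continuous_attains_sup[OF K_compact K_ne] by metis
    \<comment> \<open>With \<open>\<epsilon> j\<close> between \<open>w x / 4\<close> and \<open>w x / 2\<close>, a net point within \<open>2 \<epsilon> j\<close> of \<open>s\<close> is close
        enough, and \<open>w\<close> is still at most \<open>4 \<epsilon> j + 2 \<epsilon> j\<close> on the corresponding member.\<close>
    define j where "j = (LEAST j. \<epsilon> j \<le> w x / 2)"
    obtain n where "\<epsilon> n < w x / 2"
      using \<epsilon>_small[of "w x / 2"] w_pos[of x] by auto
    then have "\<epsilon> n \<le> w x / 2" by simp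
    then have j: "\<epsilon> j \<le> w x / 2" unfolding j_def by (rule LeastI)
    have small: "\<epsilon> j < \<epsilon>0" using j w_le[of x] \<open>\<epsilon>0 > 0\<close> by simp
    then obtain t where t: "t \<in> P j" "dist t s < 2 * \<epsilon> j" using P_net by blast
    show ?thesis
    proof (cases j)
      case 0
      then show ?thesis using small by (simp add: \<epsilon>_def)
    next
      case (Suc i)
      then have "\<not> \<epsilon> i \<le> w x / 2" using not_less_Least[of i "\<lambda>j. \<epsilon> j \<le> w x / 2"] by (simp add: j_def)
      then have "w x < 4 * \<epsilon> j" using Suc by (simp add: \<epsilon>_def)
      have "w z \<le> 6 * \<epsilon> j" if z: "z \<in> K t" for z
      proof -
        obtain z' where "z' \<in> K s" "dist z z' \<le> dist t s" using close z by blast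
        moreover from this have "w z' \<le> w x" using max by blast
        ultimately show ?thesis
          using lipschitz_one_le[OF w_lip, of z z'] t(2) \<open>w x < 4 * \<epsilon> j\<close> by linarith
      qed
      then have "t \<in> Q j" using t(1) small by (simp add: Q_def)
      then have "t \<in> N" unfolding N_def by blast
      moreover have "dist t s < w x" using t(2) j by simp
      ultimately show ?thesis using x by blast
    qed
  qed
  ultimately show ?thesis by blast
qed

section \<open>Tubes and their windowed limit\<close>

definition tube :: "'a::metric_space set \<Rightarrow> ('a \<Rightarrow> real) \<Rightarrow> real \<Rightarrow> 'a set" where
  "tube F w l = {x. infdist x F \<le> l * w x}"

definition window :: "real \<Rightarrow> nat \<Rightarrow> nat set" where
  "window l n = {k. n \<le> k \<and> real k \<le> (1 + l) * real n}"

definition nested_tubes ::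
    "(nat \<Rightarrow> 'a::metric_space set) \<Rightarrow> (nat \<Rightarrow> 'a \<Rightarrow> real) \<Rightarrow> real \<Rightarrow> 'a set" where
  "nested_tubes F w l = (\<Inter>n. \<Union>k\<in>window l n. tube (F k) (w k) l)"

lemma finite_window: "finite (window l n)"
proof (rule finite_subset)
  show "window l n \<subseteq> {..nat \<lfloor>(1 + l) * real n\<rfloor>}"
    by (auto simp: window_def le_nat_floor)
qed simp

lemma window_mono:
  assumes "l' \<le> l"
  shows "window l' n \<subseteq> window l n"
proof -
  have "(1 + l') * real n \<le> (1 + l) * real n" using assms by (intro mult_right_mono) auto
  then show ?thesis by (auto simp: window_def)
qed

lemma self_in_window: "0 \<le> l \<Longrightarrow> n \<in> window l n"
  by (simp add: window_def distrib_right)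

lemma subset_tube: "0 \<le> l \<Longrightarrow> (\<And>x. 0 < w x) \<Longrightarrow> F \<subseteq> tube F w l"
  by (auto simp: tube_def less_imp_le)

lemma tube_mono:
  assumes "l' \<le> l" "\<And>x. 0 < w x"
  shows "tube F w l' \<subseteq> tube F w l"
proof
  fix x assume "x \<in> tube F w l'"
  moreover have "l' * w x \<le> l * w x" using assms by (intro mult_right_mono) (auto simp: less_imp_le)
  ultimately show "x \<in> tube F w l" by (simp add: tube_def)
qed

lemma closed_tube:
  assumes "1-lipschitz_on UNIV w"
  shows "closed (tube F w l)"
proof -
  have "continuous_on UNIV w" by (rule lipschitz_on_continuous_on[OF assms])
  then show ?thesis
    unfolding tube_def by (intro closed_Collect_le continuous_on_infdist continuous_on_mult_left
        continuous_on_id)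
qed

text \<open>
  Moving from \<open>y\<close> by at most \<open>h\<close> raises the distance to \<open>F\<close> by at most \<open>h\<close> and lowers \<open>l * w\<close> by
  at most \<open>h\<close>; the gain \<open>(l - l') * w y\<close> from the larger parameter pays for both.
\<close>
lemma cball_subset_tube:
  assumes lip: "1-lipschitz_on UNIV w" and y: "y \<in> tube F w l'"
    and l: "0 \<le> l'" "l' < l" "l \<le> 1" and h: "3 * h \<le> (l - l') * w y"
  shows "cball y h \<subseteq> tube F w l"
proof
  fix z assume "z \<in> cball y h"
  then have z: "dist z y \<le> h" by (simp add: dist_commute)
  have "infdist z F \<le> l' * w y + h"
    using infdist_triangle[of z F y] y z by (simp add: tube_def)
  also have "\<dots> \<le> l * w y - 2 * h" using h by (simp add: algebra_simps)
  also have "\<dots> \<le> l * (w z + h) - 2 * h"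
    using lipschitz_one_le[OF lip, of y z] z l
    by (intro diff_right_mono mult_left_mono) (auto simp: dist_commute)
  also have "\<dots> \<le> l * w z"
  proof -
    have "h \<ge> 0" using z zero_le_dist order_trans by blast
    then have "l * h \<le> 1 * h" using l by (intro mult_right_mono) auto
    then show ?thesis using \<open>h \<ge> 0\<close> by (simp add: algebra_simps)
  qed
  finally show "z \<in> tube F w l" by (simp add: tube_def)
qed

lemma closed_nested_tubes:
  assumes "\<And>k. 1-lipschitz_on UNIV (w k)"
  shows "closed (nested_tubes F w l)"
  unfolding nested_tubes_def using closed_tube[OF assms] finite_window
  by (simp add: closed_INT closed_UN)

lemma nested_tubes_mono:
  assumes "l' \<le> l" "\<And>k x. 0 < w k x"
  shows "nested_tubes F w l' \<subseteq> nested_tubes F w l"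
proof -
  have "(\<Union>k\<in>window l' n. tube (F k) (w k) l') \<subseteq> (\<Union>k\<in>window l n. tube (F k) (w k) l)" for n
    using window_mono[OF assms(1)] assms by (intro UN_mono tube_mono)
  then show ?thesis unfolding nested_tubes_def by (rule INF_mono')
qed

lemma subset_nested_tubes:
  assumes "incseq F" "0 \<le> l" "\<And>k x. 0 < w k x"
  shows "F 0 \<subseteq> nested_tubes F w l"
proof -
  have "F 0 \<subseteq> tube (F n) (w n) l" for n
    using subset_tube[of l "w n" "F n"] incseqD[OF assms(1), of 0 n] assms by auto
  then show ?thesis
    unfolding nested_tubes_def using self_in_window[OF assms(2)] by blast
qed

lemma nested_tubes_subset_INT:
  assumes "decseq U" "l \<le> 1" "\<And>k x. 0 < w k x" "\<And>k. tube (F k) (w k) 1 \<subseteq> U k"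
  shows "nested_tubes F w l \<subseteq> (\<Inter>n. U n)"
proof
  fix x assume x: "x \<in> nested_tubes F w l"
  have "x \<in> U n" for n
  proof -
    obtain k where "k \<in> window l n" "x \<in> tube (F k) (w k) l"
      using x by (auto simp: nested_tubes_def)
    then have "x \<in> U k" using tube_mono[of l 1 "w k" "F k"] assms(2-4) by blast
    moreover have "n \<le> k" using \<open>k \<in> window l n\<close> by (simp add: window_def)
    ultimately show ?thesis using decseqD[OF assms(1)] by blast
  qed
  then show "x \<in> (\<Inter>n. U n)" by blast
qed

section \<open>Approximation inside the nested tubes\<close>

text \<open>
  Here \<open>m\<close> is the first level with \<open>(l - l') * w m y < 6\<delta>\<close>, and \<open>K t \<subseteq> F (m+1)\<close> approximates
  \<open>K s\<close>. Since \<open>K s\<close> lies within \<open>\<delta>\<close> of \<open>y\<close>, the value \<open>w m\<close> on \<open>K s\<close> is at most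
  \<open>(6 / (l - l') + 1)\<delta>\<close>, so the approximation error is at most \<open>2^-m\<close> times this, and
  \<open>m\<close> exceeds any bound once \<open>\<delta>\<close> is small.
\<close>
lemma approximation_in_nested_tubes:
  fixes K :: "'r::metric_space \<Rightarrow> 'y::metric_space set"
  assumes close: "\<forall>r s. \<forall>x\<in>K r. \<exists>x'\<in>K s. dist x x' \<le> dist r s"
    and inc: "incseq F"
    and w_pos: "\<And>k x. 0 < w k x" and w_le: "\<And>k x. w k x \<le> (1/2) ^ k"
    and w_lip: "\<And>k. 1-lipschitz_on UNIV (w k)"
    and net: "\<And>k s. \<exists>t. K t \<subseteq> F (Suc k) \<and> (\<exists>x\<in>K s. dist t s < (1/2) ^ k * w k x)"
    and l: "0 \<le> l'" "l' < l" "l \<le> 1" and y: "y \<in> nested_tubes F w l'" and "\<eta> > 0"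
  shows "\<exists>\<delta>1>0. \<forall>\<delta>\<in>{0<..<\<delta>1}. \<forall>s. K s \<subseteq> cball y \<delta> \<longrightarrow>
           (\<exists>t. K t \<subseteq> nested_tubes F w l \<and> dist t s < \<eta> * \<delta>)"
proof -
  define \<mu> where "\<mu> = l - l'"
  have \<mu>: "0 < \<mu>" "\<mu> \<le> 1" using l by (auto simp: \<mu>_def)
  \<comment> \<open>The approximating member must stay within \<open>2\<delta>\<close> of \<open>y\<close>, so its error is kept below \<open>\<delta>\<close> too.\<close>
  define c where "c = min \<eta> 1 / (6 / \<mu> + 1)"
  have c: "c > 0" using \<mu> \<open>\<eta> > 0\<close> by (simp add: c_def add_pos_pos)
  obtain a where a: "(1/2) ^ a < c" using real_arch_pow_inv[of c "1/2"] c by auto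
  obtain b where b: "2 / \<mu> \<le> real b" using real_arch_simple by blast
  define M where "M = max a b"
  define \<delta>1 where "\<delta>1 = Min ((\<lambda>k. \<mu> * w k y / 6) ` {..M})"
  have "\<delta>1 > 0" unfolding \<delta>1_def using \<mu> w_pos by simp
  moreover have "\<exists>t. K t \<subseteq> nested_tubes F w l \<and> dist t s < \<eta> * \<delta>"
    if \<delta>: "0 < \<delta>" "\<delta> < \<delta>1" and s: "K s \<subseteq> cball y \<delta>" for \<delta> s
  proof -
    define m where "m = (LEAST m. \<mu> * w m y < 6 * \<delta>)"
    obtain n where n: "(1/2) ^ n < 6 * \<delta>" using real_arch_pow_inv[of "6 * \<delta>" "1/2"] \<delta> by auto
    have "\<mu> * w n y \<le> 1 * w n y" using \<mu> w_pos[of n y] by (intro mult_right_mono) auto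
    then have "\<mu> * w n y < 6 * \<delta>" using w_le[of n y] n by simp
    then have m: "\<mu> * w m y < 6 * \<delta>" unfolding m_def by (rule LeastI)
    have before_m: "3 * (2 * \<delta>) \<le> (l - l') * w k y" if "k < m" for k
      using not_less_Least[of k "\<lambda>m. \<mu> * w m y < 6 * \<delta>"] that by (simp add: m_def \<mu>_def)
    have "m > M"
    proof (rule ccontr)
      assume "\<not> m > M"
      then have "\<delta>1 \<le> \<mu> * w m y / 6" unfolding \<delta>1_def by (intro Min_le) auto
      then show False using m \<delta> by simp
    qed
    obtain t x where t: "K t \<subseteq> F (Suc m)" and x: "x \<in> K s"
      and dist_t: "dist t s < (1/2) ^ m * w m x"
      using net by blast
    have "(1/2::real) ^ m \<le> (1/2) ^ a" using \<open>m > M\<close> by (intro power_decreasing) (auto simp: M_def)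
    then have cm: "(1/2::real) ^ m \<le> c" using a by (rule order_trans[OF _ less_imp_le])
    have "w m x \<le> w m y + \<delta>"
      using lipschitz_one_le[OF w_lip, of m x y] s x by (force simp: dist_commute)
    also have "\<dots> \<le> (6 / \<mu> + 1) * \<delta>" using m \<mu> by (simp add: field_simps)
    finally have "(1/2) ^ m * w m x \<le> c * ((6 / \<mu> + 1) * \<delta>)"
      using cm c w_pos[of m x] by (intro mult_mono) auto
    also have "\<dots> = min \<eta> 1 * \<delta>"
    proof -
      have "6 / \<mu> + 1 \<noteq> 0" using \<mu> by (simp add: add_pos_pos less_imp_neq[symmetric])
      then show ?thesis by (simp add: c_def)
    qed
    finally have d: "dist t s < min \<eta> 1 * \<delta>" using dist_t by simp
    have "min \<eta> 1 * \<delta> \<le> \<eta> * \<delta>" "min \<eta> 1 * \<delta> \<le> 1 * \<delta>"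
      using \<delta> by (intro mult_right_mono; simp)+
    then have ts: "dist t s < \<eta> * \<delta>" "dist t s < \<delta>" using d by auto
    have Kt: "K t \<subseteq> cball y (2 * \<delta>)"
    proof
      fix z assume "z \<in> K t"
      then obtain z' where "z' \<in> K s" "dist z z' \<le> dist t s" using close by blast
      then show "z \<in> cball y (2 * \<delta>)"
        using s ts(2) dist_triangle2[of y z z'] by force
    qed
    have late: "K t \<subseteq> tube (F k) (w k) l" if "k \<ge> Suc m" for k
      using t subset_tube[of l "w k" "F k"] incseqD[OF inc that] w_pos l by force
    have "\<exists>k\<in>window l n. K t \<subseteq> tube (F k) (w k) l" for n
    proof -
      obtain k where k: "k \<in> window l' n" "y \<in> tube (F k) (w k) l'"
        using y by (auto simp: nested_tubes_def)
      consider "k < m" | "m \<le> k" "n \<le> m" | "m < n" by linarith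
      then show ?thesis
      proof cases
        case 1
        then have "K t \<subseteq> tube (F k) (w k) l"
          using cball_subset_tube[OF w_lip k(2) l before_m] Kt by blast
        then show ?thesis using k(1) window_mono[of l' l n] l by auto
      next
        case 2
        \<comment> \<open>The window of \<open>l\<close> exceeds that of \<open>l'\<close> by \<open>\<mu> * n\<close>, and \<open>n \<ge> m / 2 \<ge> 1 / \<mu>\<close>.\<close>
        have kn: "real k \<le> (1 + l') * real n" using k(1) by (simp add: window_def)
        also have "\<dots> \<le> 2 * real n" using l by (intro mult_right_mono) auto
        finally have "real b \<le> 2 * real n" using 2 \<open>m > M\<close> by (simp add: M_def)
        then have "2 / \<mu> \<le> 2 * real n" using b by simp
        then have "1 \<le> \<mu> * real n" using \<mu> by (simp add: field_simps)
        then have "real (Suc m) \<le> (1 + l) * real n"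
          using kn 2(1) by (simp add: \<mu>_def algebra_simps)
        then have "Suc m \<in> window l n" using 2 by (simp add: window_def)
        then show ?thesis using late by blast
      next
        case 3
        then show ?thesis using late[of n] self_in_window[of l n] l by auto
      qed
    qed
    then have "K t \<subseteq> nested_tubes F w l" unfolding nested_tubes_def by blast
    then show ?thesis using ts by blast
  qed
  ultimately show ?thesis by auto
qed

section \<open>Construction of the tubes\<close>

text \<open>
  Apart from the upper bound, \<open>w\<close> is a third of the sum of the distances to \<open>F\<close> and to the
  complement of \<open>U\<close>. It is positive as these are disjoint closed sets, and a point outside \<open>U\<close>
  within \<open>w\<close> of \<open>F\<close> would be nearer to \<open>F\<close> than a third of that distance.
\<close>
lemma ex_tube_width:
  fixes F U :: "'a::metric_space set"
  assumes "closed F" "F \<noteq> {}" "open U" "F \<subseteq> U" "b > 0"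
  shows "\<exists>w. (\<forall>x. 0 < w x \<and> w x \<le> b) \<and> 1-lipschitz_on UNIV w \<and> tube F w 1 \<subseteq> U"
proof (cases "U = UNIV")
  case True
  have "1-lipschitz_on UNIV (\<lambda>x::'a. b)"
    by (intro lipschitz_onI) auto
  then show ?thesis using True \<open>b > 0\<close> by (intro exI[of _ "\<lambda>x. b"]) auto
next
  case False
  define w where "w x = min b ((infdist x F + infdist x (- U)) / 3)" for x
  have cl: "closed (- U)" "- U \<noteq> {}" using assms False by auto
  have "0 < infdist x F + infdist x (- U)" for x
  proof (cases "x \<in> F")
    case True
    then have "x \<notin> - U" using assms by auto
    then show ?thesis
      using infdist_pos_not_in_closed[OF cl] infdist_nonneg[of x F] by (simp add: add_nonneg_pos)
  next
    case False
    then show ?thesis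
      using infdist_pos_not_in_closed[OF assms(1,2)] infdist_nonneg[of x "- U"] by (simp add: add_pos_nonneg)
  qed
  then have "0 < w x \<and> w x \<le> b" for x using \<open>b > 0\<close> by (simp add: w_def)
  moreover have "1-lipschitz_on UNIV w"
  proof (rule lipschitz_onI)
    fix x y :: 'a
    have "\<bar>min b p - min b q\<bar> \<le> \<bar>p - q\<bar>" for p q by (auto simp: min_def)
    then have "dist (w x) (w y) \<le>
        \<bar>(infdist x F + infdist x (- U)) / 3 - (infdist y F + infdist y (- U)) / 3\<bar>"
      unfolding w_def dist_real_def .
    also have "\<dots> \<le> 1 * dist x y"
      using infdist_triangle_abs[of x F y] infdist_triangle_abs[of x "- U" y] zero_le_dist[of x y]
      by (simp add: abs_le_iff field_simps)
    finally show "dist (w x) (w y) \<le> 1 * dist x y" .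
  qed simp
  moreover have "tube F w 1 \<subseteq> U"
  proof (rule ccontr)
    assume "\<not> ?thesis"
    then obtain x where x: "infdist x F \<le> w x" "x \<in> - U" by (auto simp: tube_def)
    have "infdist x (- U) = 0" using x by simp
    then have "infdist x F \<le> infdist x F / 3" using x(1) by (simp add: w_def)
    then have "infdist x F = 0" using infdist_nonneg[of x F] by simp
    then have "x \<in> F" using assms in_closed_iff_infdist_zero by blast
    then show False using x assms by blast
  qed
  ultimately show ?thesis by blast
qed

text \<open>
  Widths and indices are chosen alternately: the width at level \<open>n\<close> depends on the indices already
  present, and the net added next is finer than this width by the factor \<open>2^-n\<close>. It is because
  these factors tend to \<open>0\<close> that errors of size \<open>\<eta> * \<delta>\<close> can be reached for every \<open>\<eta>\<close>.
\<close>
lemma ex_tube_sequence: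
  fixes K :: "'r::metric_space \<Rightarrow> 'y::metric_space set" and U :: "nat \<Rightarrow> 'y set"
  assumes K_ne: "\<And>r. K r \<noteq> {}" and K_compact: "\<And>r. compact (K r)"
    and U: "\<And>n. open (U n)" "\<And>n. (\<Union>r\<in>D. K r) \<subseteq> U n"
    and r0: "r0 \<in> D" and "\<epsilon>0 > 0"
    and net: "\<forall>w. (\<forall>x. 0 < w x \<and> w x \<le> \<epsilon>0) \<and> 1-lipschitz_on UNIV w \<longrightarrow>
      (\<exists>N\<subseteq>D. closed (\<Union>r\<in>N. K r) \<and> (\<forall>s. \<exists>t\<in>N. \<exists>x\<in>K s. dist t s < w x))"
  obtains F w where "incseq F" "K r0 \<subseteq> F 0"
    "\<And>k x. 0 < w k x" "\<And>k x. w k x \<le> (1/2) ^ k" "\<And>k. 1-lipschitz_on UNIV (w k)"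
    "\<And>k. tube (F k) (w k) 1 \<subseteq> U k"
    "\<And>k s. \<exists>t. K t \<subseteq> F (Suc k) \<and> (\<exists>x\<in>K s. dist t s < (1/2) ^ k * w k x)"
proof -
  define ok where "ok M \<longleftrightarrow> M \<subseteq> D \<and> r0 \<in> M \<and> closed (\<Union>r\<in>M. K r)" for M
  define width where "width n M w \<longleftrightarrow> (\<forall>x. 0 < w x \<and> w x \<le> min \<epsilon>0 ((1/2) ^ n)) \<and>
      1-lipschitz_on UNIV w \<and> tube (\<Union>r\<in>M. K r) w 1 \<subseteq> U n" for n M w
  define finer where "finer n M M' \<longleftrightarrow> M \<subseteq> M' \<and> (\<exists>w. width n M w \<and>
      (\<forall>s. \<exists>t\<in>M'. \<exists>x\<in>K s. dist t s < (1/2) ^ n * w x))" for n M M'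
  have "\<exists>M. \<forall>n. ok (M n) \<and> finer n (M n) (M (Suc n))"
  proof (rule dependent_nat_choice)
    show "\<exists>M. ok M"
      using r0 compact_imp_closed[OF K_compact] by (intro exI[of _ "{r0}"]) (simp add: ok_def)
  next
    fix M n assume M: "ok M"
    have "closed (\<Union>r\<in>M. K r)" "(\<Union>r\<in>M. K r) \<noteq> {}" "(\<Union>r\<in>M. K r) \<subseteq> U n"
      using M K_ne[of r0] U(2)[of n] by (auto simp: ok_def)
    then obtain w where w: "width n M w"
      using ex_tube_width[of "\<Union>r\<in>M. K r" "U n" "min \<epsilon>0 ((1/2) ^ n)"] U(1)[of n] \<open>\<epsilon>0 > 0\<close>
      unfolding width_def by auto
    let ?v = "\<lambda>x. (1/2) ^ n * w x"
    have "0 < ?v x \<and> ?v x \<le> \<epsilon>0" for x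
    proof -
      have w_x: "0 < w x" "w x \<le> \<epsilon>0" using w by (auto simp: width_def)
      then have "?v x \<le> 1 * w x" by (intro mult_right_mono) (auto simp: power_le_one less_imp_le)
      also have "\<dots> \<le> \<epsilon>0" using w_x by simp
      finally show ?thesis using w_x by simp
    qed
    moreover have "1-lipschitz_on UNIV ?v"
      using w lipschitz_on_cmult_real_upper[of 1 UNIV w "(1/2) ^ n" 1]
      by (simp add: width_def power_le_one)
    ultimately have "\<exists>N\<subseteq>D. closed (\<Union>r\<in>N. K r) \<and> (\<forall>s. \<exists>t\<in>N. \<exists>x\<in>K s. dist t s < ?v x)"
      by (intro net[rule_format] conjI allI) auto
    then obtain N where N: "N \<subseteq> D" "closed (\<Union>r\<in>N. K r)"
      "\<And>s. \<exists>t\<in>N. \<exists>x\<in>K s. dist t s < ?v x" by blast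
    have "ok (M \<union> N)" using M N by (auto simp: ok_def UN_Un)
    moreover have "finer n M (M \<union> N)" using w N(3) unfolding finer_def by blast
    ultimately show "\<exists>M'. ok M' \<and> finer n M M'" by blast
  qed
  then obtain M where M: "\<And>n. ok (M n)" "\<And>n. finer n (M n) (M (Suc n))" by blast
  have "\<exists>w. \<forall>n. width n (M n) (w n) \<and>
      (\<forall>s. \<exists>t\<in>M (Suc n). \<exists>x\<in>K s. dist t s < (1/2) ^ n * w n x)"
    by (rule choice, rule allI) (use M(2) in \<open>simp add: finer_def\<close>)
  then obtain w where w: "\<And>n. width n (M n) (w n)"
    and fine: "\<And>n s. \<exists>t\<in>M (Suc n). \<exists>x\<in>K s. dist t s < (1/2) ^ n * w n x"
    by blast
  define F where "F n = (\<Union>r\<in>M n. K r)" for n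
  show thesis
  proof
    show "incseq F"
      using M(2) by (intro incseq_SucI) (auto simp: F_def finer_def)
    show "K r0 \<subseteq> F 0" using M(1)[of 0] by (auto simp: F_def ok_def)
    show "0 < w k x" "w k x \<le> (1/2) ^ k" for k x using w[of k] by (auto simp: width_def)
    show "1-lipschitz_on UNIV (w k)" "tube (F k) (w k) 1 \<subseteq> U k" for k
      using w[of k] by (auto simp: width_def F_def)
    show "\<exists>t. K t \<subseteq> F (Suc k) \<and> (\<exists>x\<in>K s. dist t s < (1/2) ^ k * w k x)" for k s
      using fine[of k s] by (auto simp: F_def)
  qed
qed

theorem theorem3p3:
  fixes K :: "'r::metric_space \<Rightarrow> 'y::metric_space set"
    and G :: "'y set"
    and r0 :: 'r
    and \<rho> \<epsilon>0 :: real
  assumes K_ne: "\<And>r. K r \<noteq> {}"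
    and K_compact: "\<And>r. compact (K r)"
    and K_Hausdorff: "\<And>r s. hausdorff_dist (K r) (K s) \<le> dist r s"
    and G_gdelta: "gdelta_in euclidean G"
    and G_dense: "\<exists>R'. closure R' = UNIV \<and> (\<forall>r\<in>R'. K r \<subseteq> G)"
    and r0: "K r0 \<subseteq> G"
    and rho_pos: "\<rho> > 0"
    and eps0_pos: "\<epsilon>0 > 0"
    and R_eps: "\<And>\<epsilon>. 0 < \<epsilon> \<Longrightarrow> \<epsilon> < \<epsilon>0 \<Longrightarrow>
      \<exists>R\<epsilon>. (\<forall>s. \<exists>t\<in>R\<epsilon>. dist t s < \<epsilon>) \<and>
           (\<forall>S. bounded S \<and> diameter S \<le> \<rho> * \<epsilon> \<longrightarrow> finite {r\<in>R\<epsilon>. S \<inter> K r \<noteq> {}})"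
  shows "\<exists>T :: real \<Rightarrow> 'y set.
      (\<forall>l\<in>{0..1}. T l \<noteq> {} \<and> closed (T l) \<and> T l \<subseteq> G \<and> K r0 \<subseteq> T l) \<and>
      (\<forall>l' l. 0 \<le> l' \<and> l' \<le> l \<and> l \<le> 1 \<longrightarrow> T l' \<subseteq> T l) \<and>
      (\<forall>\<eta>>0. \<forall>l\<in>{0<..1}. \<forall>y\<in>(\<Union>l'\<in>{0..<l}. T l').
        \<exists>\<delta>1>0. \<forall>\<delta>\<in>{0<..<\<delta>1}. \<forall>s. K s \<subseteq> cball y \<delta> \<longrightarrow>
          (\<exists>t. K t \<subseteq> T l \<and> dist t s < \<eta> * \<delta>))"
proof -
  have close: "\<forall>r s. \<forall>x\<in>K r. \<exists>x'\<in>K s. dist x x' \<le> dist r s"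
    by (intro allI ballI
        hausdorff_dist_le_imp_close_point[OF K_compact K_compact K_ne K_ne K_Hausdorff])
  define D where "D = {r. K r \<subseteq> G}"
  obtain R' where R': "closure R' = UNIV" "\<forall>r\<in>R'. K r \<subseteq> G" using G_dense by blast
  then have "R' \<subseteq> D" by (auto simp: D_def)
  then have dense: "closure D = UNIV" using closure_mono[of R' D] R'(1) by auto
  obtain U where U: "\<And>n. open (U n)" "\<And>n. U (Suc n) \<subseteq> U n" "\<Inter>(range U) = G"
    using G_gdelta by (auto simp: gdelta_in_descending)
  have nets: "\<exists>P\<subseteq>D. (\<forall>s. \<exists>t\<in>P. dist t s < 2 * \<epsilon>) \<and>
            (\<forall>y. finite {t\<in>P. cball y (\<rho> * \<epsilon> / 4) \<inter> K t \<noteq> {}})"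
    if \<epsilon>: "0 < \<epsilon>" "\<epsilon> < \<epsilon>0" for \<epsilon>
  proof -
    obtain R where "\<And>s. \<exists>t\<in>R. dist t s < \<epsilon>"
      "\<And>S. bounded S \<Longrightarrow> diameter S \<le> \<rho> * \<epsilon> \<Longrightarrow> finite {r\<in>R. S \<inter> K r \<noteq> {}}"
      using R_eps[OF \<epsilon>] by blast
    then show ?thesis by (rule net_in_dense_subset[OF close dense rho_pos \<epsilon>(1)])
  qed
  have net: "\<forall>w. (\<forall>x. 0 < w x \<and> w x \<le> \<epsilon>0) \<and> 1-lipschitz_on UNIV w \<longrightarrow>
      (\<exists>N\<subseteq>D. closed (\<Union>r\<in>N. K r) \<and> (\<forall>s. \<exists>t\<in>N. \<exists>x\<in>K s. dist t s < w x))"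
  proof (intro allI impI, elim conjE)
    fix w :: "'y \<Rightarrow> real"
    assume w: "\<forall>x. 0 < w x \<and> w x \<le> \<epsilon>0" "1-lipschitz_on UNIV w"
    show "\<exists>N\<subseteq>D. closed (\<Union>r\<in>N. K r) \<and> (\<forall>s. \<exists>t\<in>N. \<exists>x\<in>K s. dist t s < w x)"
    proof (rule variable_scale_net[OF K_ne K_compact close rho_pos eps0_pos _ _ _ w(2)])
      show "0 < w x" "w x \<le> \<epsilon>0" for x using w(1) by auto
    qed (rule nets)
  qed
  have D_sub: "(\<Union>r\<in>D. K r) \<subseteq> U n" for n using U(3) by (auto simp: D_def)
  have r0_D: "r0 \<in> D" using r0 by (simp add: D_def)
  obtain F w where F: "incseq F" "K r0 \<subseteq> F 0"
    and w: "\<And>k x. 0 < w k x" "\<And>k x. w k x \<le> (1/2) ^ k" "\<And>k. 1-lipschitz_on UNIV (w k)"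
      "\<And>k. tube (F k) (w k) 1 \<subseteq> U k"
    and fine: "\<And>k s. \<exists>t. K t \<subseteq> F (Suc k) \<and> (\<exists>x\<in>K s. dist t s < (1/2) ^ k * w k x)"
    by (rule ex_tube_sequence[where U = U, OF K_ne K_compact U(1) D_sub r0_D eps0_pos net]) blast
  have "decseq U" using U(2) by (rule decseq_SucI)
  have T: "nested_tubes F w l \<noteq> {} \<and> closed (nested_tubes F w l) \<and> nested_tubes F w l \<subseteq> G \<and>
      K r0 \<subseteq> nested_tubes F w l" if "l \<in> {0..1}" for l
  proof (intro conjI)
    show r0_sub: "K r0 \<subseteq> nested_tubes F w l"
      using subset_nested_tubes[of F l w] F w(1) that by auto
    then show "nested_tubes F w l \<noteq> {}" using K_ne[of r0] by blast
    show "closed (nested_tubes F w l)" using w(3) by (rule closed_nested_tubes)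
    show "nested_tubes F w l \<subseteq> G"
      using nested_tubes_subset_INT[OF \<open>decseq U\<close> _ w(1) w(4), of l] U(3) that by auto
  qed
  have approx: "\<exists>\<delta>1>0. \<forall>\<delta>\<in>{0<..<\<delta>1}. \<forall>s. K s \<subseteq> cball y \<delta> \<longrightarrow>
      (\<exists>t. K t \<subseteq> nested_tubes F w l \<and> dist t s < \<eta> * \<delta>)"
    if \<eta>: "\<eta> > 0" and l: "l \<in> {0<..1}" and y: "y \<in> (\<Union>l'\<in>{0..<l}. nested_tubes F w l')" for \<eta> l y
  proof -
    obtain l' where l': "0 \<le> l'" "l' < l" "y \<in> nested_tubes F w l'" using y by auto
    have "l \<le> 1" using l by simp
    then show ?thesis
      by (rule approximation_in_nested_tubes[OF close F(1) w(1-3) fine l'(1,2) _ l'(3) \<eta>])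
  qed
  show ?thesis
  proof (intro exI[of _ "nested_tubes F w"] conjI)
    show "\<forall>l' l. 0 \<le> l' \<and> l' \<le> l \<and> l \<le> 1 \<longrightarrow> nested_tubes F w l' \<subseteq> nested_tubes F w l"
      using nested_tubes_mono[of _ _ w, OF _ w(1)] by auto
  qed (intro ballI allI impI T approx; assumption)+
qed

end
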